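(* Let $n$ and $k$ be integers with $1\le k\le n$. Let $f(x)$ be a nonzero polynomial with nonnegative integer coefficients, and let $\vec{s}=(s_1,\dots,s_k)$ be a $k$-tuple of positive integers such that either $\deg f(x)\ge 2$, or $f(x)$ is linear and $s_j\ge 2$ for all integers $j$ with $1\le j\le k$. Then $H_{k,f}(\vec{s},n)$ and $H^*_{k,f}(\vec{s},n)$ are not integers, except in the case where $f(x)=x^m$ for some integer $m\ge 1$ and $n=k=1$; in that exceptional case both $H_{k,f}(\vec{s},n)$ and $H^*_{k,f}(\vec{s},n)$ are integers.
   Context: For integers $1\le k\le n$, a polynomial $f(x)$ with integer coefficients such that $f(m)\neq 0$ for every positive integer $m$, and a $k$-tuple $\vec{s}=(s_1,\dots,s_k)$ of positive integers, define $$H_{k,f}(\vec{s},n)=\sum_{1\le i_1<\cdots<i_k\le n}\prod_{j=1}^k\frac{1}{f(i_j)^{s_j}},\qquad H^*_{k,f}(\vec{s},n)=\sum_{1\le i_1\le\cdots\le i_k\le n}\prod_{j=1}^k\frac{1}{f(i_j)^{s_j}}.$$ (A nonzero polynomial with nonnegative integer coefficients satisfies $f(m)>0$ for all positive integers $m$.) *)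

theory Defs
  imports Complex_Main "HOL-Library.FuncSet" "HOL-Computational_Algebra.Polynomial"
begin

text \<open>
  A \<open>k\<close>-tuple \<open>s\<close> is a function of which only the values at \<open>1, \<dots>, k\<close> matter; an index tuple
  \<open>i\<^sub>1, \<dots>, i\<^sub>k\<close> is an extensional function, so that each tuple is counted exactly once.
  The sums are meaningful when \<open>f\<close> has no positive integer root (otherwise \<open>1 / 0 = 0\<close> applies).
\<close>

definition mult_harm :: "nat \<Rightarrow> int poly \<Rightarrow> (nat \<Rightarrow> nat) \<Rightarrow> nat \<Rightarrow> real" where
  "mult_harm k f s n =
     (\<Sum>i \<in> {i \<in> {1..k} \<rightarrow>\<^sub>E {1..n}. strict_mono_on {1..k} i}.
        \<Prod>j = 1..k. 1 / of_int (poly f (int (i j))) ^ s j)"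

definition mult_harm_star :: "nat \<Rightarrow> int poly \<Rightarrow> (nat \<Rightarrow> nat) \<Rightarrow> nat \<Rightarrow> real" where
  "mult_harm_star k f s n =
     (\<Sum>i \<in> {i \<in> {1..k} \<rightarrow>\<^sub>E {1..n}. mono_on {1..k} i}.
        \<Prod>j = 1..k. 1 / of_int (poly f (int (i j))) ^ s j)"

end

theory Submission
  imports Defs
begin

text \<open>
  Peeling off the largest index turns both sums into iterated sums with weights
  \<open>1 / f(m)^s\<^sub>j \<le> 1 / m\<^sup>2\<close>, and size alone excludes integers.
  For \<open>k \<ge> 2\<close> the strict sum lies in \<open>(0, 1)\<close>. The star sum is at most \<open>2n / (n + 1) < 2\<close>, because this
  sequence is a fixed point of summation against \<open>1 / m\<^sup>2\<close>; if \<open>f(1) = 1\<close>, that is \<open>f = x^m\<close>, it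
  also exceeds its all-ones term 1. If \<open>f(1) \<ge> 2\<close>, the weights are at most \<open>1 / (m\<^sup>2 + 1)\<close>, and the
  star sum stays below 1 for \<open>k \<ge> 2\<close>. For \<open>k = 1\<close> and \<open>f(1) \<ge> 2\<close> the sum is below 1 unless
  \<open>f = x\<^sup>2 + 1\<close> and \<open>s\<^sub>1 = 1\<close>, where the partial sums jump over 1 at \<open>n = 13\<close> and never reach 2.
\<close>

section \<open>Index tuples and iterated sums\<close>

text \<open>The map \<open>c\<close> caps the next smaller index: \<open>\<lambda>m. m - 1\<close>
  gives the strict sum and \<open>\<lambda>m. m\<close> the star sum, so one recursion serves
  both.\<close>

fun nested_sum :: "(nat \<Rightarrow> nat) \<Rightarrow> (nat \<Rightarrow> nat \<Rightarrow> real) \<Rightarrow> nat \<Rightarrow> nat \<Rightarrow> real" where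
  "nested_sum c g 0 n = 1"
| "nested_sum c g (Suc k) n = (\<Sum>m = 1..n. nested_sum c g k (c m) * g (Suc k) m)"

lemma sum_index_tuples_eq_nested_sum:
  fixes A :: "nat \<Rightarrow> nat \<Rightarrow> (nat \<Rightarrow> nat) set"
  assumes A0: "\<And>n. A 0 n = {\<lambda>_. undefined}"
    and ASuc: "\<And>k n. A (Suc k) n = (\<lambda>(m, i). i(Suc k := m)) ` (SIGMA m:{1..n}. A k (c m))"
    and ext: "\<And>k n. A k n \<subseteq> extensional {1..k}"
  shows "(\<Sum>i\<in>A k n. \<Prod>j = 1..k. g j (i j)) = nested_sum c g k n"
proof -
  have fin: "finite (A k n)" for k n
    by (induction k arbitrary: n) (auto simp: A0 ASuc)
  show ?thesis
  proof (induction k arbitrary: n)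
    case 0
    then show ?case by (simp add: A0)
  next
    case (Suc k)
    have inj: "inj_on (\<lambda>(m, i). i(Suc k := m)) (SIGMA m:{1..n}. A k (c m))"
    proof (rule inj_onI, clarify)
      fix m i m' i'
      assume i: "i \<in> A k (c m)" "i' \<in> A k (c m')" and eq: "i(Suc k := m) = i'(Suc k := m')"
      have "i (Suc k) = undefined" "i' (Suc k) = undefined"
        using subsetD[OF ext i(1)] subsetD[OF ext i(2)] by (simp_all add: extensional_def)
      \<comment> \<open>Extensionality makes the update reversible: resetting the new coordinate to
        \<open>undefined\<close> recovers the shorter tuple.\<close>
      then have "i = (i(Suc k := m))(Suc k := undefined)" "i' = (i'(Suc k := m'))(Suc k := undefined)"
        by auto
      with eq show "m = m' \<and> i = i'"
        by (metis fun_upd_same)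
    qed
    have "(\<Sum>i\<in>A (Suc k) n. \<Prod>j = 1..Suc k. g j (i j)) =
        (\<Sum>(m, i)\<in>(SIGMA m:{1..n}. A k (c m)). (\<Prod>j = 1..k. g j (i j)) * g (Suc k) m)"
      unfolding ASuc sum.reindex[OF inj]
      by (intro sum.cong refl) (auto simp: prod.nat_ivl_Suc' mult.commute intro!: prod.cong)
    also have "\<dots> = (\<Sum>m = 1..n. \<Sum>i\<in>A k (c m). (\<Prod>j = 1..k. g j (i j)) * g (Suc k) m)"
      by (rule sum.Sigma[symmetric]) (auto simp: fin)
    also have "\<dots> = nested_sum c g (Suc k) n"
      by (simp add: Suc.IH del: One_nat_def flip: sum_distrib_right)
    finally show ?case .
  qed
qed

text \<open>The last entry \<open>m\<close> is the largest, so it can be split off. For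
  \<open>m = 1\<close> the cap \<open>m - 1\<close> is 0 and leaves no shorter tuple unless
  \<open>k = 0\<close>, as it should.\<close>

lemma increasing_tuples_Suc:
  fixes n :: nat
  shows "{i \<in> {1..Suc k} \<rightarrow>\<^sub>E {1..n}. strict_mono_on {1..Suc k} i} =
    (\<lambda>(m, i). i(Suc k := m)) `
      (SIGMA m:{1..n}. {i \<in> {1..k} \<rightarrow>\<^sub>E {1..m - 1}. strict_mono_on {1..k} i})"
  (is "?L = ?R")
proof (intro equalityI subsetI)
  fix i assume i: "i \<in> ?L"
  have lt: "i j < i (Suc k)" if "j \<in> {1..k}" for j
    using i that by (auto simp: strict_mono_on_def)
  have "i = (restrict i {1..k})(Suc k := i (Suc k))"
    using i by (auto simp: fun_eq_iff PiE_def extensional_def)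
  moreover have "i (Suc k) \<in> {1..n}"
    using i by (auto simp: PiE_def Pi_def)
  moreover have "i j \<in> {1..i (Suc k) - 1}" if "j \<in> {1..k}" for j
    using i lt[OF that] PiE_mem[of i "{1..Suc k}" "\<lambda>_. {1..n}" j] that
    by (auto simp: le_diff_conv2)
  then have "restrict i {1..k} \<in> {1..k} \<rightarrow>\<^sub>E {1..i (Suc k) - 1}"
    by (auto simp: PiE_def Pi_def)
  moreover have "strict_mono_on {1..k} (restrict i {1..k})"
    using i by (auto simp: strict_mono_on_def)
  ultimately show "i \<in> ?R"
    by (intro image_eqI[of _ _ "(i (Suc k), restrict i {1..k})"]) auto
next
  fix i' assume "i' \<in> ?R"
  then obtain m i where m: "m \<in> {1..n}" and i: "i \<in> {1..k} \<rightarrow>\<^sub>E {1..m - 1}" "strict_mono_on {1..k} i"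
    and i': "i' = i(Suc k := m)" by auto
  have bd: "1 \<le> i j \<and> i j < m" if "j \<in> {1..k}" for j
    using PiE_mem[OF i(1) that] m by auto
  have "i' j \<in> {1..n}" if "j \<in> {1..Suc k}" for j
    using that m bd[of j] by (cases "j = Suc k") (auto simp: i')
  moreover have "i' j = undefined" if "j \<notin> {1..Suc k}" for j
    using that i(1) by (auto simp: i' PiE_def extensional_def)
  moreover have "strict_mono_on {1..Suc k} i'"
  proof (rule strict_mono_onI)
    fix a b assume "a \<in> {1..Suc k}" "b \<in> {1..Suc k}" "a < b"
    then show "i' a < i' b"
      using bd[of a] strict_mono_onD[OF i(2), of a b] by (cases "b = Suc k"; cases "a = Suc k") (auto simp: i')
  qed
  ultimately show "i' \<in> ?L" by (auto simp: PiE_iff extensional_def)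
qed

lemma nondecreasing_tuples_Suc:
  fixes n :: nat
  shows "{i \<in> {1..Suc k} \<rightarrow>\<^sub>E {1..n}. mono_on {1..Suc k} i} =
    (\<lambda>(m, i). i(Suc k := m)) `
      (SIGMA m:{1..n}. {i \<in> {1..k} \<rightarrow>\<^sub>E {1..m}. mono_on {1..k} i})"
  (is "?L = ?R")
proof (intro equalityI subsetI)
  fix i assume i: "i \<in> ?L"
  have le: "i j \<le> i (Suc k)" if "j \<in> {1..k}" for j
    using i that by (auto simp: mono_on_def)
  have "i = (restrict i {1..k})(Suc k := i (Suc k))"
    using i by (auto simp: fun_eq_iff PiE_def extensional_def)
  moreover have "i (Suc k) \<in> {1..n}"
    using i by (auto simp: PiE_def Pi_def)
  moreover have "i j \<in> {1..i (Suc k)}" if "j \<in> {1..k}" for j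
    using i le[OF that] PiE_mem[of i "{1..Suc k}" "\<lambda>_. {1..n}" j] that by auto
  then have "restrict i {1..k} \<in> {1..k} \<rightarrow>\<^sub>E {1..i (Suc k)}"
    by (auto simp: PiE_def Pi_def)
  moreover have "mono_on {1..k} (restrict i {1..k})"
    using i by (auto simp: mono_on_def)
  ultimately show "i \<in> ?R"
    by (intro image_eqI[of _ _ "(i (Suc k), restrict i {1..k})"]) auto
next
  fix i' assume "i' \<in> ?R"
  then obtain m i where m: "m \<in> {1..n}" and i: "i \<in> {1..k} \<rightarrow>\<^sub>E {1..m}" "mono_on {1..k} i"
    and i': "i' = i(Suc k := m)" by auto
  have bd: "1 \<le> i j \<and> i j \<le> m" if "j \<in> {1..k}" for j
    using PiE_mem[OF i(1) that] m by auto
  have "i' j \<in> {1..n}" if "j \<in> {1..Suc k}" for j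
    using that m bd[of j] by (cases "j = Suc k") (auto simp: i')
  moreover have "i' j = undefined" if "j \<notin> {1..Suc k}" for j
    using that i(1) by (auto simp: i' PiE_def extensional_def)
  moreover have "mono_on {1..Suc k} i'"
  proof (rule mono_onI)
    fix a b assume "a \<in> {1..Suc k}" "b \<in> {1..Suc k}" "a \<le> b"
    then show "i' a \<le> i' b"
      using bd[of a] mono_onD[OF i(2), of a b] by (cases "b = Suc k"; cases "a = Suc k") (auto simp: i')
  qed
  ultimately show "i' \<in> ?L" by (auto simp: PiE_iff extensional_def)
qed

lemma mult_harm_eq_nested_sum:
  "mult_harm k f s n =
    nested_sum (\<lambda>m. m - 1) (\<lambda>j m. 1 / of_int (poly f (int m)) ^ s j) k n"
  unfolding mult_harm_def
  by (rule sum_index_tuples_eq_nested_sum, simp_all only: increasing_tuples_Suc)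
    (auto simp: strict_mono_on_def PiE_def)

lemma mult_harm_star_eq_nested_sum:
  "mult_harm_star k f s n =
    nested_sum (\<lambda>m. m) (\<lambda>j m. 1 / of_int (poly f (int m)) ^ s j) k n"
  unfolding mult_harm_star_def
  by (rule sum_index_tuples_eq_nested_sum, simp_all only: nondecreasing_tuples_Suc)
    (auto simp: mono_on_def PiE_def)

section \<open>Positivity of iterated sums\<close>

lemma nested_sum_nonneg:
  assumes "\<And>j m. j \<in> {1..k} \<Longrightarrow> m \<ge> 1 \<Longrightarrow> 0 \<le> g j m"
  shows "0 \<le> nested_sum c g k n"
  using assms by (induction k arbitrary: n) (auto intro!: sum_nonneg)

lemma nested_sum_strict_pos:
  assumes "\<And>j m. j \<in> {1..k} \<Longrightarrow> m \<ge> 1 \<Longrightarrow> 0 < g j m" and "k \<le> n"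
  shows "0 < nested_sum (\<lambda>m. m - 1) g k n"
  using assms
proof (induction k arbitrary: n)
  case (Suc k)
  \<comment> \<open>The term \<open>m = n\<close> suffices: \<open>Suc k \<le> n\<close> leaves
    \<open>k \<le> n - 1\<close> for the other indices, whereas a smaller \<open>m\<close> may leave
    an empty inner sum.\<close>
  have "0 < nested_sum (\<lambda>m. m - 1) g k (n - 1) * g (Suc k) n"
    using Suc.prems by (intro mult_pos_pos Suc.IH) auto
  moreover have "0 \<le> nested_sum (\<lambda>m. m - 1) g k (m - 1) * g (Suc k) m" if "m \<in> {1..n}" for m
    using that Suc.prems by (intro mult_nonneg_nonneg nested_sum_nonneg less_imp_le) auto
  ultimately show ?case
    using Suc.prems(2) by (auto intro!: sum_pos2[where i = n])
qed simp

lemma nested_sum_star_pos: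
  assumes "\<And>j m. j \<in> {1..k} \<Longrightarrow> m \<ge> 1 \<Longrightarrow> 0 < g j m" and "1 \<le> n"
  shows "0 < nested_sum (\<lambda>m. m) g k n"
  using assms by (induction k arbitrary: n) (auto intro!: sum_pos mult_pos_pos)

section \<open>Upper and lower bounds for iterated sums\<close>

text \<open>Reduces a bound on a sum to the choice of a discrete antiderivative \<open>b\<close>.
  The value \<open>b 0\<close> stays free, so that a first term smaller than the general pattern can
  be exploited.\<close>

lemma sum_le_telescope:
  fixes u b :: "nat \<Rightarrow> real"
  assumes "\<And>m. m \<in> {1..n} \<Longrightarrow> u m \<le> b m - b (m - 1)"
  shows "(\<Sum>m = 1..n. u m) \<le> b n - b 0"
  using assms
proof (induction n)
  case (Suc n)
  then have "(\<Sum>m = 1..n. u m) \<le> b n - b 0" "u (Suc n) \<le> b (Suc n) - b n"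
    using Suc.prems[of "Suc n"] by auto
  then show ?case by simp
qed simp

text \<open>The estimate comes from \<open>1 / m\<^sup>2 < 1 / (m - 1/2) - 1 / (m + 1/2)\<close>.\<close>

lemma sum_le_inverse_squares:
  fixes w :: "nat \<Rightarrow> real"
  assumes "\<And>m. 2 \<le> m \<Longrightarrow> w m \<le> 1 / real m ^ 2" and "1 \<le> n"
  shows "(\<Sum>m = 1..n. w m) \<le> w 1 + 2 / 3 - 2 / (2 * real n + 1)"
  using assms(2)
proof (induction n rule: nat_induct_at_least)
  case base
  then show ?case by simp
next
  case (Suc n)
  have "w (Suc n) \<le> 1 / (real n + 1) ^ 2"
    using assms(1)[of "Suc n"] Suc.hyps by (simp add: add.commute)
  also have "\<dots> \<le> 2 / (2 * real n + 1) - 2 / (2 * real n + 3)"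
    by (simp add: divide_simps) (simp add: power2_eq_square algebra_simps)
  finally show ?case
    using Suc.IH by (simp add: add.commute)
qed

lemma sum_lt_inverse_squares:
  fixes w :: "nat \<Rightarrow> real"
  assumes "\<And>m. 2 \<le> m \<Longrightarrow> w m \<le> 1 / real m ^ 2" and "1 \<le> n"
  shows "(\<Sum>m = 1..n. w m) < w 1 + 2 / 3"
proof -
  have "(\<Sum>m = 1..n. w m) \<le> w 1 + 2 / 3 - 2 / (2 * real n + 1)"
    using assms by (rule sum_le_inverse_squares)
  also have "\<dots> < w 1 + 2 / 3" by simp
  finally show ?thesis .
qed

text \<open>
  The induction step is the identity \<open>m / (m + 1) - (m - 1) / m = (m / (m + 1)) / m\<^sup>2\<close>.
\<close>

lemma nested_sum_star_le:
  assumes g: "\<And>j m. j \<in> {1..k} \<Longrightarrow> m \<ge> 1 \<Longrightarrow> 0 \<le> g j m \<and> g j m \<le> 1 / real m ^ 2"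
    and base: "\<And>n. 1 \<le> n \<Longrightarrow> nested_sum (\<lambda>m. m) g l n \<le> C * (real n / (real n + 1))"
    and "0 \<le> C" "l \<le> k" "1 \<le> n"
  shows "nested_sum (\<lambda>m. m) g k n \<le> C * (real n / (real n + 1))"
  using \<open>l \<le> k\<close> g \<open>1 \<le> n\<close>
proof (induction k arbitrary: n rule: dec_induct)
  case base
  then show ?case using assms(2) by blast
next
  case (step k)
  let ?b = "\<lambda>m. C * (real m / (real m + 1))"
  have "nested_sum (\<lambda>m. m) g k m * g (Suc k) m \<le> ?b m - ?b (m - 1)" if "m \<in> {1..n}" for m
  proof -
    have "nested_sum (\<lambda>m. m) g k m * g (Suc k) m \<le> ?b m * (1 / real m ^ 2)"
      using step that \<open>0 \<le> C\<close> by (intro mult_mono) (auto intro!: step.IH)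
    also have "\<dots> = ?b m - ?b (m - 1)"
      using that by (simp add: of_nat_diff divide_simps) (simp add: power2_eq_square algebra_simps)
    finally show ?thesis .
  qed
  from sum_le_telescope[of n _ ?b, OF this] show ?case by simp
qed

lemma nested_sum_star_lt_2:
  assumes "\<And>j m. j \<in> {1..k} \<Longrightarrow> m \<ge> 1 \<Longrightarrow> 0 \<le> g j m \<and> g j m \<le> 1 / real m ^ 2" and "1 \<le> n"
  shows "nested_sum (\<lambda>m. m) g k n < 2"
proof -
  have "nested_sum (\<lambda>m. m) g k n \<le> 2 * (real n / (real n + 1))"
    \<comment> \<open>The empty sum 1 is at most \<open>2 * (n / (n + 1))\<close> for
      \<open>n \<ge> 1\<close>, which dictates \<open>C = 2\<close>.\<close>
    by (rule nested_sum_star_le[where l = 0]) (use assms in \<open>auto simp: divide_simps\<close>)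
  also have "\<dots> < 2" by (simp add: field_simps)
  finally show ?thesis .
qed

lemma nested_sum_star_gt_1:
  assumes "\<And>j m. j \<in> {1..k} \<Longrightarrow> m \<ge> 1 \<Longrightarrow> 0 < g j m"
    and g1: "\<And>j. j \<in> {1..k} \<Longrightarrow> g j 1 = 1" and "1 \<le> k" "2 \<le> n"
  shows "1 < nested_sum (\<lambda>m. m) g k n"
proof -
  obtain l where k: "k = Suc l"
    using \<open>1 \<le> k\<close> by (cases k) auto
  have one: "nested_sum (\<lambda>m. m) g l 1 = 1"
    using g1 unfolding k by (induction l) auto
  \<comment> \<open>Largest index 1 means the all-ones tuple, contributing exactly 1; largest index
    2 adds something positive.\<close>
  have "(\<Sum>m\<in>{1, 2}. nested_sum (\<lambda>m. m) g l m * g (Suc l) m)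
      \<le> (\<Sum>m = 1..n. nested_sum (\<lambda>m. m) g l m * g (Suc l) m)"
    using assms k
    by (intro sum_mono2 mult_nonneg_nonneg nested_sum_nonneg) (auto intro: less_imp_le)
  moreover have "0 < nested_sum (\<lambda>m. m) g l 2 * g (Suc l) 2"
    using assms k by (intro mult_pos_pos nested_sum_star_pos) auto
  ultimately show ?thesis
    using one g1[of "Suc l"] k by simp
qed

text \<open>The bound \<open>n / (n + 1)\<close> can fail for a single sum, as 1/2 + 1/5 > 2/3. It
  holds for double sums, so the fixed-point induction starts at level 2 with constant 1.\<close>

lemma nested_sum_star_lt_1:
  assumes g: "\<And>j m. j \<in> {1..k} \<Longrightarrow> m \<ge> 1 \<Longrightarrow> 0 \<le> g j m \<and> g j m \<le> 1 / (real m ^ 2 + 1)"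
    and "2 \<le> k" "1 \<le> n"
  shows "nested_sum (\<lambda>m. m) g k n < 1"
proof -
  have g': "0 \<le> g j m \<and> g j m \<le> 1 / real m ^ 2" if "j \<in> {1..k}" "m \<ge> 1" for j m
  proof -
    have "1 / (real m ^ 2 + 1) \<le> 1 / real m ^ 2"
      using that by (intro divide_left_mono mult_pos_pos add_nonneg_pos) auto
    then show ?thesis using g[OF that] by linarith
  qed
  \<comment> \<open>Here 7/6 = 1/2 + 2/3, since \<open>g j 1 \<le> 1 / 2\<close>.\<close>
  have S: "(\<Sum>m = 1..n. g j m) \<le> 7 / 6 - 2 / (2 * real n + 1)" if "j \<in> {1..k}" "1 \<le> n" for j n
    using sum_le_inverse_squares[of "g j" n] g[of j 1] g'[of j] that by fastforce
  \<comment> \<open>This isolates the fixed point \<open>n / (n + 1)\<close> and leaves a constant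
    excess of 1/6.\<close>
  have S': "(\<Sum>m = 1..n. g j m) \<le> real n / (real n + 1) + 1 / 6" if "j \<in> {1..k}" "1 \<le> n" for j n
  proof -
    have "7 / 6 - 2 / (2 * real n + 1) \<le> real n / (real n + 1) + 1 / 6"
      by (simp add: divide_simps) (simp add: algebra_simps)
    then show ?thesis using S[OF that] by linarith
  qed
  have "nested_sum (\<lambda>m. m) g 2 n \<le> 1 * (real n / (real n + 1))" if "1 \<le> n" for n
  proof -
    \<comment> \<open>With \<open>b 0 = 1 / 4\<close> the first increment is 1/4, matching the bound
      1/2 times 1/2 on the term \<open>m = 1\<close>; this saves 1/4 against the plain fixed
      point.\<close>
    define b where "b m = (if m = 0 then 1 / 4 else real m / (real m + 1))" for m :: nat
    have b: "real m / (real m + 1) * g 2 m \<le> b m - b (m - 1)" if "m \<in> {1..n}" for m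
    proof (cases "m = 1")
      case True
      then show ?thesis
        using g[of 2 1] \<open>2 \<le> k\<close> by (simp add: b_def)
    next
      case False
      have "real m / (real m + 1) * g 2 m \<le> real m / (real m + 1) * (1 / real m ^ 2)"
        using g'[of 2 m] \<open>2 \<le> k\<close> that by (intro mult_left_mono) auto
      also have "\<dots> = b m - b (m - 1)"
        using that False
        by (simp add: b_def of_nat_diff divide_simps) (simp add: power2_eq_square algebra_simps)
      finally show ?thesis .
    qed
    have "nested_sum (\<lambda>m. m) g 2 n = (\<Sum>m = 1..n. (\<Sum>l = 1..m. g 1 l) * g 2 m)"
      by (simp add: numeral_2_eq_2)
    also have "\<dots> \<le> (\<Sum>m = 1..n. (real m / (real m + 1) + 1 / 6) * g 2 m)"
      using S'[of 1] g[of 2] \<open>2 \<le> k\<close> by (intro sum_mono mult_right_mono) auto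
    also have "\<dots> = (\<Sum>m = 1..n. real m / (real m + 1) * g 2 m) + 1 / 6 * (\<Sum>m = 1..n. g 2 m)"
      by (simp add: distrib_right sum.distrib sum_distrib_left)
    also have "\<dots> \<le> (b n - b 0) + 1 / 6 * (7 / 6)"
    proof (intro add_mono mult_left_mono)
      have "(\<Sum>m = 1..n. g 2 m) \<le> 7 / 6 - 2 / (2 * real n + 1)"
        using \<open>2 \<le> k\<close> \<open>1 \<le> n\<close> by (intro S) auto
      also have "\<dots> \<le> 7 / 6" by simp
      finally show "(\<Sum>m = 1..n. g 2 m) \<le> 7 / 6" .
    qed (use sum_le_telescope[of n _ b, OF b] in auto)
    \<comment> \<open>The excess 7/36 is smaller than the saving 1/4 = 9/36.\<close>
    also have "\<dots> \<le> 1 * (real n / (real n + 1))"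
      using \<open>1 \<le> n\<close> by (simp add: b_def)
    finally show ?thesis .
  qed
  note base = this
  have "nested_sum (\<lambda>m. m) g k n \<le> 1 * (real n / (real n + 1))"
    by (rule nested_sum_star_le[where l = 2]) (use base g' assms in auto)
  also have "\<dots> < 1" by simp
  finally show ?thesis .
qed

text \<open>Double sums are at most ((5/3)^2 - 1)/2 = 8/9. From there on, an inner sum below 1
  leaves only the tail of the inverse squares from \<open>m = 2\<close>, which is below 2/3.\<close>

lemma nested_sum_strict_lt_1:
  assumes g: "\<And>j m. j \<in> {1..k} \<Longrightarrow> m \<ge> 1 \<Longrightarrow> 0 \<le> g j m \<and> g j m \<le> 1 / real m ^ 2"
    and "2 \<le> k"
  shows "nested_sum (\<lambda>m. m - 1) g k n < 1"
  using \<open>2 \<le> k\<close> g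
proof (induction k arbitrary: n rule: dec_induct)
  case base
  define B where "B n = (\<Sum>m = 1..n. 1 / real m ^ 2)" for n
  have B: "B n \<le> 5 / 3" for n
  proof (cases "n = 0")
    case False
    then show ?thesis
      using sum_lt_inverse_squares[of "\<lambda>m. 1 / real m ^ 2" n] by (simp add: B_def)
  qed (simp add: B_def)
  have B0: "0 \<le> B n" for n
    unfolding B_def by (intro sum_nonneg) auto
  \<comment> \<open>The left side is half the off-diagonal part of \<open>(B n)\<^sup>2\<close>, whose diagonal part is at least 1.\<close>
  have B2: "(\<Sum>m = 1..n. B (m - 1) * (1 / real m ^ 2)) \<le> ((B n)\<^sup>2 - 1) / 2" if "1 \<le> n" for n
    using that
  proof (induction n rule: nat_induct_at_least)
    case base
    then show ?case by (simp add: B_def)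
  next
    case (Suc n)
    define x where "x = 1 / real (Suc n) ^ 2"
    have "(\<Sum>m = 1..Suc n. B (m - 1) * (1 / real m ^ 2)) =
        (\<Sum>m = 1..n. B (m - 1) * (1 / real m ^ 2)) + B n * x"
      by (simp add: x_def)
    moreover have "B (Suc n) = B n + x"
      by (simp add: B_def x_def)
    then have "((B (Suc n))\<^sup>2 - 1) / 2 = ((B n)\<^sup>2 - 1) / 2 + B n * x + x\<^sup>2 / 2"
      by (simp add: power2_eq_square field_simps)
    ultimately show ?case
      using Suc.IH zero_le_power2[of x] by linarith
  qed
  show ?case
  proof (cases "n = 0")
    case False
    have "nested_sum (\<lambda>m. m - 1) g 2 n = (\<Sum>m = 1..n. (\<Sum>l = 1..m - 1. g 1 l) * g 2 m)"
      by (simp add: numeral_2_eq_2)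
    also have "\<dots> \<le> (\<Sum>m = 1..n. B (m - 1) * (1 / real m ^ 2))"
      unfolding B_def using base
      by (intro sum_mono mult_mono sum_nonneg) auto
    also have "\<dots> \<le> ((B n)\<^sup>2 - 1) / 2"
      using False by (intro B2) auto
    also have "\<dots> \<le> ((5 / 3)\<^sup>2 - 1) / 2"
      using power_mono[OF B B0, of n 2] by simp
    also have "\<dots> < 1" by (simp add: power2_eq_square)
    finally show ?thesis .
  qed (simp add: numeral_2_eq_2)
next
  case (step k)
  \<comment> \<open>The weight at 1 may be 0 because no nonempty increasing tuple lies below the
    largest index 1.\<close>
  define w where "w m = (if m = 1 then 0 else 1 / real m ^ 2)" for m :: nat
  have "nested_sum (\<lambda>m. m - 1) g k (m - 1) * g (Suc k) m \<le> w m" if "m \<in> {1..n}" for m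
  proof (cases "m = 1")
    case True
    then show ?thesis using \<open>2 \<le> k\<close> by (cases k) (auto simp: w_def)
  next
    case False
    have "nested_sum (\<lambda>m. m - 1) g k (m - 1) * g (Suc k) m \<le> 1 * (1 / real m ^ 2)"
      using step.prems that by (intro mult_mono less_imp_le[OF step.IH]) auto
    then show ?thesis using False by (simp add: w_def)
  qed
  then have le: "nested_sum (\<lambda>m. m - 1) g (Suc k) n \<le> (\<Sum>m = 1..n. w m)"
    by (auto intro: sum_mono)
  show ?case
  proof (cases "n = 0")
    case False
    have "(\<Sum>m = 1..n. w m) < w 1 + 2 / 3"
      using False by (intro sum_lt_inverse_squares) (auto simp: w_def)
    then show ?thesis using le by (simp add: w_def)
  qed auto
qed

section \<open>Single sums\<close>

lemma sum_lt_1_of_le_third: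
  fixes w :: "nat \<Rightarrow> real"
  assumes "\<And>m. 2 \<le> m \<Longrightarrow> w m \<le> 1 / real m ^ 2" "w 1 \<le> 1 / 3"
  shows "(\<Sum>m = 1..n. w m) < 1"
proof (cases "n = 0")
  case False
  then have "(\<Sum>m = 1..n. w m) < w 1 + 2 / 3"
    using assms(1) by (intro sum_lt_inverse_squares) auto
  then show ?thesis using assms(2) by linarith
qed auto

text \<open>With first term 1/2 the inverse-square estimate only gives 7/6. The pronic bound
  telescopes, through \<open>1 / (m * (m + 1)) = m / (m + 1) - (m - 1) / m\<close>.\<close>

lemma sum_lt_1_of_le_pronic:
  fixes w :: "nat \<Rightarrow> real"
  assumes "\<And>m. 1 \<le> m \<Longrightarrow> w m \<le> 1 / (real m * (real m + 1))"
  shows "(\<Sum>m = 1..n. w m) < 1"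
proof -
  have "w m \<le> real m / (real m + 1) - real (m - 1) / (real (m - 1) + 1)" if "m \<in> {1..n}" for m
  proof -
    have "1 / (real m * (real m + 1)) = real m / (real m + 1) - real (m - 1) / (real (m - 1) + 1)"
      using that by (simp add: of_nat_diff divide_simps) (simp add: algebra_simps)
    then show ?thesis using assms[of m] that by simp
  qed
  from sum_le_telescope[of n w "\<lambda>m. real m / (real m + 1)", OF this]
  have "(\<Sum>m = 1..n. w m) \<le> real n / (real n + 1)" by simp
  also have "\<dots> < 1" by simp
  finally show ?thesis .
qed

lemma sum_inverse_square_plus_1_notin_Ints:
  assumes "1 \<le> n"
  shows "(\<Sum>m = 1..n. 1 / (real m ^ 2 + 1)) \<notin> \<int>"
proof -
  define S where "S n = (\<Sum>m = 1..n. 1 / (real m ^ 2 + 1))" for n :: nat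
  have mono: "S m \<le> S n" if "m \<le> n" for m n
    unfolding S_def using that by (intro sum_mono2) auto
  have "S 1 \<le> S n" using assms by (rule mono)
  then have pos: "0 < S n" by (simp add: S_def)
  \<comment> \<open>Exact evaluation of two consecutive partial sums; by monotonicity no partial sum
    equals 1.\<close>
  have S12: "S 12 < 1" and S13: "1 < S 13"
    by (simp_all add: S_def eval_nat_numeral(3) numeral_eq_Suc)
  have "S n < 1 / (real 1 ^ 2 + 1) + 2 / 3"
    unfolding S_def using assms by (intro sum_lt_inverse_squares) (auto intro!: divide_left_mono mult_pos_pos add_nonneg_pos)
  then have lt2: "S n < 2" by simp
  have ne1: "S n \<noteq> 1"
    using mono[of n 12] mono[of 13 n] S12 S13 by (cases "n \<le> 12") auto
  show ?thesis
  proof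
    assume "(\<Sum>m = 1..n. 1 / (real m ^ 2 + 1)) \<in> \<int>"
    then obtain z where z: "S n = of_int z"
      unfolding S_def by (elim Ints_cases)
    with pos lt2 have "z = 1" by simp
    with z ne1 show False by simp
  qed
qed


section \<open>Integer polynomials with nonnegative coefficients\<close>

lemma poly_nonneg_coeffs_mono:
  fixes p :: "int poly"
  assumes "\<And>i. 0 \<le> coeff p i" "1 \<le> x"
  shows "poly p 1 \<le> poly p x"
  unfolding poly_altdef using assms by (intro sum_mono mult_left_mono) auto

text \<open>The value at 1 is the sum of the coefficients, and the leading one already uses up the
  total 1.\<close>

lemma eq_monom_of_poly_1_eq_1:
  fixes p :: "int poly"
  assumes nonneg: "\<And>i. 0 \<le> coeff p i" and "poly p 1 = 1"
  shows "p = monom 1 (degree p)"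
proof -
  let ?d = "degree p"
  have "p \<noteq> 0" using assms(2) by auto
  then have lead: "1 \<le> coeff p ?d"
    using nonneg[of ?d] leading_coeff_neq_0[of p] by linarith
  have split: "(\<Sum>i<?d. coeff p i) + coeff p ?d = 1"
    using assms(2) by (simp add: poly_altdef flip: lessThan_Suc_atMost)
  have "0 \<le> (\<Sum>i<?d. coeff p i)"
    using nonneg by (intro sum_nonneg) auto
  with lead split have sum0: "(\<Sum>i<?d. coeff p i) = 0" and lead1: "coeff p ?d = 1"
    by linarith+
  have "coeff p i = 0" if "i < ?d" for i
    using sum0 nonneg that by (subst (asm) sum_nonneg_eq_0_iff) auto
  then have "coeff p i = coeff (monom 1 ?d) i" for i
    using lead1 coeff_eq_0[of p i] by (cases i ?d rule: linorder_cases) auto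
  then show ?thesis by (intro poly_eqI)
qed

text \<open>By integrality the leading coefficient is at least 1, so one copy of the top power can
  be removed; \<open>q\<close> may still have the same degree.\<close>

lemma nonneg_coeffs_split_lead:
  fixes f :: "int poly"
  assumes "f \<noteq> 0" "\<And>i. 0 \<le> coeff f i"
  obtains q where "f = monom 1 (degree f) + q" "\<And>i. 0 \<le> coeff q i"
proof
  show "f = monom 1 (degree f) + (f - monom 1 (degree f))" by simp
  have "1 \<le> coeff f (degree f)"
    using assms(2)[of "degree f"] leading_coeff_neq_0[OF assms(1)] by linarith
  then show "0 \<le> coeff (f - monom 1 (degree f)) i" for i
    using assms(2)[of i] by auto
qed

text \<open>The remainder after removing the top power is monotone and takes the value
  \<open>poly f 1 - 1\<close> at 1.\<close>

lemma poly_ge_power_degree: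
  fixes f :: "int poly"
  assumes "f \<noteq> 0" "\<And>i. 0 \<le> coeff f i" "1 \<le> x"
  shows "x ^ degree f + (poly f 1 - 1) \<le> poly f x"
proof -
  obtain q where q: "f = monom 1 (degree f) + q" "\<And>i. 0 \<le> coeff q i"
    using nonneg_coeffs_split_lead assms(1,2) by blast
  have "poly f y = y ^ degree f + poly q y" for y
    by (subst q(1)) (simp add: poly_monom)
  then show ?thesis
    using poly_nonneg_coeffs_mono[OF q(2) assms(3)] by simp
qed

text \<open>The value 2 at 1 forces \<open>f\<close> to be a sum of two powers of x with coefficient
  1. Only x^2 + 1 among them, in degree at least 2, falls short of x^2 + x.\<close>

lemma poly_ge_pronic:
  fixes f :: "int poly"
  assumes "f \<noteq> 0" "\<And>i. 0 \<le> coeff f i" "2 \<le> degree f" "poly f 1 = 2"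
    and ne: "f \<noteq> monom 1 2 + 1" and x: "1 \<le> x"
  shows "x * (x + 1) \<le> poly f x"
proof -
  let ?d = "degree f"
  obtain q where q: "f = monom 1 ?d + q" "\<And>i. 0 \<le> coeff q i"
    using nonneg_coeffs_split_lead assms(1,2) by blast
  have pf: "poly f y = y ^ ?d + poly q y" for y
    by (subst q(1)) (simp add: poly_monom)
  then have "q = monom 1 (degree q)"
    using q(2) assms(4) by (intro eq_monom_of_poly_1_eq_1) auto
  then obtain l where l: "q = monom 1 l" by blast
  have eq: "poly f x = x ^ ?d + x ^ l"
    by (simp add: pf l poly_monom)
  show ?thesis
  proof (cases "l = 0")
    case False
    have "x ^ 2 \<le> x ^ ?d" "x ^ 1 \<le> x ^ l"
      using x assms(3) False by (intro power_increasing; simp)+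
    then show ?thesis using eq by (simp add: power2_eq_square algebra_simps)
  next
    case True
    have "?d \<noteq> 2"
    proof
      assume "?d = 2"
      then have "f = monom 1 2 + monom 1 0" using q(1) l True by simp
      then show False using ne by simp
    qed
    then have "x ^ 3 \<le> x ^ ?d"
      using x assms(3) by (intro power_increasing) auto
    \<comment> \<open>This product expands to x^3 - x^2 - x + 1.\<close>
    moreover have "0 \<le> (x - 1) ^ 2 * (x + 1)" using x by simp
    then have "x * (x + 1) \<le> x ^ 3 + 1"
      by (simp add: power2_eq_square power3_eq_cube algebra_simps)
    ultimately show ?thesis using eq True by simp
  qed
qed

section \<open>Non-integrality of the harmonic sums\<close>

lemma notin_Ints_between:
  fixes x :: real
  assumes "of_int z < x" "x < of_int (z + 1)"
  shows "x \<notin> \<int>"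
  using assms by (auto elim!: Ints_cases)

theorem theorem1p1:
  fixes n k :: nat and f :: "int poly" and s :: "nat \<Rightarrow> nat"
  assumes "1 \<le> k" and "k \<le> n"
    and "f \<noteq> 0" and "\<forall>i. coeff f i \<ge> 0"
    and "\<forall>j\<in>{1..k}. s j > 0"
    and "degree f \<ge> 2 \<or> (degree f = 1 \<and> (\<forall>j\<in>{1..k}. s j \<ge> 2))"
  shows "(\<not> ((\<exists>m\<ge>1. f = monom 1 m) \<and> n = 1 \<and> k = 1) \<longrightarrow>
            mult_harm k f s n \<notin> \<int> \<and> mult_harm_star k f s n \<notin> \<int>) \<and>
         ((\<exists>m\<ge>1. f = monom 1 m) \<and> n = 1 \<and> k = 1 \<longrightarrow>
            mult_harm k f s n \<in> \<int> \<and> mult_harm_star k f s n \<in> \<int>)"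
proof -
  define g :: "nat \<Rightarrow> nat \<Rightarrow> real" where "g j m = 1 / of_int (poly f (int m)) ^ s j" for j m
  let ?H = "nested_sum (\<lambda>m. m - 1) g k n"
  let ?S = "nested_sum (\<lambda>m. m) g k n"
  have HS: "mult_harm k f s n = ?H" "mult_harm_star k f s n = ?S"
    unfolding mult_harm_eq_nested_sum mult_harm_star_eq_nested_sum g_def by simp_all
  have nonneg: "0 \<le> coeff f i" for i
    using assms(4) by blast
  have f1: "1 \<le> poly f 1"
  proof -
    have "coeff f (degree f) \<le> poly f 1"
      unfolding poly_altdef using nonneg by (auto intro!: member_le_sum)
    then show ?thesis
      using nonneg[of "degree f"] leading_coeff_neq_0[OF assms(3)] by linarith
  qed
  have lower: "int m ^ degree f + (poly f 1 - 1) \<le> poly f (int m)" if "1 \<le> m" for m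
    using that by (intro poly_ge_power_degree assms(3) nonneg) auto
  have f_pos: "1 \<le> poly f (int m)" if "1 \<le> m" for m
    using poly_nonneg_coeffs_mono[of f "int m"] nonneg f1 that by force
  \<comment> \<open>One bound for both alternatives on degree and exponents: it yields weights at
    most \<open>1 / m^2\<close> always, and at most \<open>1 / (m^2 + 1)\<close> once
    \<open>poly f 1 \<ge> 2\<close>.\<close>
  have pow_ge: "int m ^ 2 + (poly f 1 - 1) \<le> poly f (int m) ^ s j"
    if "j \<in> {1..k}" "1 \<le> m" for j m
  proof (cases "2 \<le> degree f")
    case True
    then have "int m ^ 2 \<le> int m ^ degree f"
      using that by (intro power_increasing) auto
    moreover have "poly f (int m) ^ 1 \<le> poly f (int m) ^ s j"
      using f_pos[OF that(2)] assms(5) that by (intro power_increasing) (auto simp: Suc_le_eq)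
    ultimately show ?thesis using lower[OF that(2)] by simp
  next
    case False
    then have d: "degree f = 1" "2 \<le> s j" using assms(6) that by auto
    define c where "c = poly f 1 - 1"
    have c: "0 \<le> c" using f1 by (simp add: c_def)
    have "int m ^ 2 + c \<le> (int m + c) ^ 2"
    proof -
      \<comment> \<open>The cross term of the square absorbs \<open>c\<close>.\<close>
      have "c * 1 \<le> c * (2 * int m)" using c that by (intro mult_left_mono) auto
      then have "c \<le> 2 * int m * c" by (simp add: ac_simps)
      then show ?thesis
        using zero_le_power2[of c] unfolding power2_sum by linarith
    qed
    also have "\<dots> \<le> poly f (int m) ^ 2"
      using lower[OF that(2)] c d by (intro power_mono) (auto simp: c_def)
    also have "\<dots> \<le> poly f (int m) ^ s j"
      using f_pos[OF that(2)] d by (intro power_increasing) auto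
    finally show ?thesis by (simp add: c_def)
  qed
  have g_le: "g j m \<le> 1 / of_int z" if "0 < z" "z \<le> poly f (int m) ^ s j" for j m z
  proof -
    have "of_int z \<le> (of_int (poly f (int m)) ^ s j :: real)"
      using that(2) by (metis of_int_le_iff of_int_power)
    then show ?thesis
      unfolding g_def using that(1) by (intro frac_le) auto
  qed
  have g_pos: "0 < g j m" if "1 \<le> m" for j m
    using f_pos[OF that] by (simp add: g_def)
  have g_sq: "0 \<le> g j m \<and> g j m \<le> 1 / real m ^ 2" if "j \<in> {1..k}" "1 \<le> m" for j m
  proof -
    have "int m ^ 2 \<le> poly f (int m) ^ s j"
      using pow_ge[OF that] f1 by linarith
    then show ?thesis
      using g_le[of "int m ^ 2" m j] g_pos[of m j] that by simp
  qed
  have H_nonint: "?H \<notin> \<int>" if "2 \<le> k"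
  proof -
    have "0 < ?H"
      using g_pos assms(2) by (intro nested_sum_strict_pos) auto
    moreover have "?H < 1"
      using g_sq that by (intro nested_sum_strict_lt_1) auto
    ultimately show ?thesis by (intro notin_Ints_between[of 0]) auto
  qed
  \<comment> \<open>For \<open>k = 1\<close> both sums coincide, so the strict sum inherits the
    result for the star sum.\<close>
  have k1: "?H = (\<Sum>m = 1..n. g 1 m)" "?S = (\<Sum>m = 1..n. g 1 m)" if "k = 1"
    using that by simp_all
  have S_pos: "0 < ?S"
    using g_pos assms(1,2) by (intro nested_sum_star_pos) auto
  have S_nonint: "?S \<notin> \<int>" if ex: "\<not> ((\<exists>m\<ge>1. f = monom 1 m) \<and> n = 1 \<and> k = 1)"
  proof (cases "poly f 1 = 1")
    case True
    then have "f = monom 1 (degree f)"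
      using nonneg by (intro eq_monom_of_poly_1_eq_1)
    moreover have "1 \<le> degree f" using assms(6) by auto
    ultimately have "n \<noteq> 1 \<or> k \<noteq> 1" using ex by blast
    \<comment> \<open>If \<open>n = 1\<close>, then \<open>k \<le> n\<close> would give
      \<open>k = 1\<close>, the excluded case.\<close>
    then have "2 \<le> n" using assms(1,2) by linarith
    have "g j 1 = 1" for j using True by (simp add: g_def)
    then have "1 < ?S"
      using g_pos \<open>2 \<le> n\<close> assms(1) by (intro nested_sum_star_gt_1) auto
    moreover have "?S < 2"
      using g_sq \<open>2 \<le> n\<close> by (intro nested_sum_star_lt_2) auto
    ultimately show ?thesis by (intro notin_Ints_between[of 1]) auto
  next
    case False
    then have f2: "2 \<le> poly f 1" using f1 by simp
    have nonint: "?S \<notin> \<int>" if "?S < 1"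
      by (rule notin_Ints_between[of 0]) (use S_pos that in auto)
    \<comment> \<open>For \<open>k = 1\<close>, a first term of at most 1/3 leaves room for a tail
      below 2/3; otherwise the first term is 1/2, which forces \<open>s 1 = 1\<close> and
      \<open>poly f 1 = 2\<close>.\<close>
    consider "2 \<le> k" | "k = 1" "3 \<le> poly f 1 ^ s 1" | "k = 1" "poly f 1 ^ s 1 < 3"
      using assms(1) by linarith
    then show ?thesis
    proof cases
      case 1
      have "0 \<le> g j m \<and> g j m \<le> 1 / (real m ^ 2 + 1)" if "j \<in> {1..k}" "1 \<le> m" for j m
      proof -
        have "int m ^ 2 + 1 \<le> poly f (int m) ^ s j"
          using pow_ge[OF that] f2 by linarith
        then show ?thesis
          using g_le[of "int m ^ 2 + 1" m j] g_pos[of m j] that by (simp add: add_pos_nonneg)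
      qed
      then show ?thesis
        using 1 assms(1,2) by (intro nonint nested_sum_star_lt_1) auto
    next
      case 2
      then have "g 1 1 \<le> 1 / 3" using g_le[of 3 1 1] by simp
      then have "(\<Sum>m = 1..n. g 1 m) < 1"
        using g_sq 2 by (intro sum_lt_1_of_le_third) auto
      then show ?thesis using nonint k1 2 by simp
    next
      case 3
      have s1: "s 1 = 1"
      proof (rule ccontr)
        assume "s 1 \<noteq> 1"
        then have "2 \<le> s 1" using assms(5) 3 by force
        then have "poly f 1 ^ 2 \<le> poly f 1 ^ s 1"
          using f2 by (intro power_increasing) auto
        moreover have "2 ^ 2 \<le> poly f 1 ^ 2"
          using f2 by (intro power_mono) auto
        ultimately show False using 3 by simp
      qed
      then have f12: "poly f 1 = 2" using 3 f2 by simp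
      have d: "2 \<le> degree f" using assms(6) 3 s1 by auto
      show ?thesis
      proof (cases "f = monom 1 2 + 1")
        case True
        then have "g 1 m = 1 / (real m ^ 2 + 1)" for m
          using s1 by (simp add: g_def poly_monom)
        then show ?thesis
          using sum_inverse_square_plus_1_notin_Ints[of n] k1 3 assms(1,2) by simp
      next
        case False
        have "g 1 m \<le> 1 / (real m * (real m + 1))" if "1 \<le> m" for m
        proof -
          have "int m * (int m + 1) \<le> poly f (int m) ^ s 1"
            using poly_ge_pronic[OF assms(3) nonneg d f12 False, of "int m"] that s1 by simp
          then show ?thesis
            using g_le[of "int m * (int m + 1)" m 1] that by (simp add: zero_less_mult_iff)
        qed
        then have "(\<Sum>m = 1..n. g 1 m) < 1"
          by (intro sum_lt_1_of_le_pronic)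
        then show ?thesis using nonint k1 3 by simp
      qed
    qed
  qed
  have "?H \<notin> \<int> \<and> ?S \<notin> \<int>" if "\<not> ((\<exists>m\<ge>1. f = monom 1 m) \<and> n = 1 \<and> k = 1)"
    using S_nonint[OF that] H_nonint k1 assms(1) by (cases "k = 1") auto
  moreover have "?H \<in> \<int> \<and> ?S \<in> \<int>" if "\<exists>m\<ge>1. f = monom 1 m" "n = 1" "k = 1"
    using that by (auto simp: g_def poly_monom)
  ultimately show ?thesis unfolding HS by blast
qed

end
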